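(* Let $\mathcal{V}$ be a scalar product space of finite dimension $d$ over a field $\mathcal{F}$, with scalar product $g$. Two bases $\{x_1,\ldots,x_d\}$ and $\{x_1',\ldots,x_d'\}$ of $\mathcal{V}$ yield the same Hodge star on $\bigwedge\mathcal{V}$ up to sign if and only if they have the same Gram determinant, i.e. $\det[g(x_i,x_j)]=\det[g(x_i',x_j')]$.
   Context: A scalar product on $\mathcal{V}$ is a symmetric nondegenerate bilinear functional $g:\mathcal{V}\times\mathcal{V}\to\mathcal{F}$ (no definiteness assumed). Given an ordered basis $\{x_1,\ldots,x_d\}$ of $\mathcal{V}$, the reciprocal basis $\{x_1^{\bot},\ldots,x_d^{\bot}\}$ is the basis of $\mathcal{V}$ determined by $g(x_i^{\bot},x_j)=\delta_{i,j}$. The Hodge star $\ast:\bigwedge\mathcal{V}\to\bigwedge\mathcal{V}$ yielded by this basis is the linear map such that $$\ast(x_{i_1}\wedge\cdots\wedge x_{i_n})=(-1)^{\rho}\cdot x_{i_{n+1}}^{\bot}\wedge\cdots\wedge x_{i_d}^{\bot}$$ for every $n$ and every permutation $\rho=(i_1,\ldots,i_d)$ of $(1,\ldots,d)$, where $(-1)^{\rho}$ is the sign of $\rho$ and empty products equal $1$. Two Hodge stars $\ast,\ast'$ are the same up to sign if $\ast'=\ast$ or $\ast'=-\ast$ on all of $\bigwedge\mathcal{V}$. *)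

theory Defs
  imports
    "HOL-Library.Poly_Mapping"
    "HOL-Library.FuncSet"
    "HOL-Combinatorics.Permutations"
    "HOL-Algebra.QuotRing"
    "HOL-Algebra.Module"
    "HOL-Algebra.Algebraic_Closure_Type"
    "Jordan_Normal_Form.Determinant"
begin

section \<open>Scalar product spaces and ordered bases\<close>

text \<open>
  Ordered bases are families indexed by \<open>{0..<d}\<close> (rather than \<open>{1..d}\<close>); the values of the
  family outside this index set are irrelevant.
\<close>

definition (in vector_space) ordered_basis :: "nat \<Rightarrow> (nat \<Rightarrow> 'b) \<Rightarrow> bool" where
  "ordered_basis d x \<longleftrightarrow>
     inj_on x {0..<d} \<and> independent (x ` {0..<d}) \<and> span (x ` {0..<d}) = UNIV"

locale scalar_product_space = vector_space scale
  for scale :: "'f::field \<Rightarrow> 'v::ab_group_add \<Rightarrow> 'v" +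
  fixes g :: "'v \<Rightarrow> 'v \<Rightarrow> 'f"
  assumes finite_dimensional: "\<exists>B. finite B \<and> span B = UNIV"
    and linear_left: "Vector_Spaces.linear scale (*) (\<lambda>u. g u v)"
    and linear_right: "Vector_Spaces.linear scale (*) (\<lambda>v. g u v)"
    and symmetric: "g u v = g v u"
    and nondegenerate: "(\<And>v. g u v = 0) \<Longrightarrow> u = 0"

definition reciprocal_basis ::
    "('v \<Rightarrow> 'v \<Rightarrow> 'f::field) \<Rightarrow> nat \<Rightarrow> (nat \<Rightarrow> 'v) \<Rightarrow> nat \<Rightarrow> 'v" where
  "reciprocal_basis g d x i = (THE y. \<forall>j<d. g y (x j) = (if i = j then 1 else 0))"


section \<open>The exterior algebra\<close>

text \<open>
  \<open>'v free_word \<Rightarrow>\<^sub>0 'f\<close> is the free unital associative \<open>'f\<close>-algebra on the set of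
  all vectors. Modulo the relations making the generators additive and homogeneous in the vector it
  is the tensor algebra; the relations \<open>v \<otimes> v = 0\<close> then give the exterior algebra. All these
  relations are imposed at once. (Relations \<open>v \<otimes> v = 0\<close> are used, not just anticommutativity, so
  that the definition is also the right one in characteristic 2.)
\<close>

datatype 'v free_word = Word (letters: "'v list")

instantiation free_word :: (type) monoid_add
begin

definition zero_free_word :: "'a free_word" where
  "0 = Word []"

definition plus_free_word :: "'a free_word \<Rightarrow> 'a free_word \<Rightarrow> 'a free_word" where
  "u + w = Word (letters u @ letters w)"

instance
  by standard (simp_all add: zero_free_word_def plus_free_word_def)

end

definition free_gen :: "'v \<Rightarrow> 'v free_word \<Rightarrow>\<^sub>0 'f::field" where
  "free_gen v = Poly_Mapping.single (Word [v]) 1"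

definition free_const :: "'f \<Rightarrow> 'v free_word \<Rightarrow>\<^sub>0 'f::field" where
  "free_const c = Poly_Mapping.single 0 c"

abbreviation free_alg :: "('v free_word \<Rightarrow>\<^sub>0 'f::field) ring" where
  "free_alg \<equiv> ring_of_type_algebra"

definition exterior_relations ::
    "('f \<Rightarrow> 'v \<Rightarrow> 'v) \<Rightarrow> ('v::ab_group_add free_word \<Rightarrow>\<^sub>0 'f::field) set" where
  "exterior_relations scale =
     {free_gen (u + v) - (free_gen u + free_gen v) | u v. True} \<union>
     {free_gen (scale c v) - free_const c * free_gen v | c v. True} \<union>
     {free_gen v * free_gen v | v. True}"

definition exterior_ideal ::
    "('f \<Rightarrow> 'v \<Rightarrow> 'v) \<Rightarrow> ('v::ab_group_add free_word \<Rightarrow>\<^sub>0 'f::field) set" where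
  "exterior_ideal scale = Idl\<^bsub>free_alg\<^esub> (exterior_relations scale)"

definition exterior_class ::
    "('f \<Rightarrow> 'v \<Rightarrow> 'v) \<Rightarrow> ('v::ab_group_add free_word \<Rightarrow>\<^sub>0 'f::field) \<Rightarrow> ('v free_word \<Rightarrow>\<^sub>0 'f) set" where
  "exterior_class scale a = exterior_ideal scale +>\<^bsub>free_alg\<^esub> a"

definition exterior_algebra ::
    "('f \<Rightarrow> 'v \<Rightarrow> 'v) \<Rightarrow> ('f::field, ('v::ab_group_add free_word \<Rightarrow>\<^sub>0 'f) set) module" where
  "exterior_algebra scale =
     (let Q = free_alg Quot exterior_ideal scale in
      \<lparr>carrier = carrier Q, monoid.mult = monoid.mult Q, one = one Q, zero = zero Q, add = add Q,
       module.smult = (\<lambda>c w. exterior_class scale (free_const c) \<otimes>\<^bsub>Q\<^esub> w)\<rparr>)"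

definition wedge ::
    "('f::field \<Rightarrow> 'v \<Rightarrow> 'v) \<Rightarrow> 'v::ab_group_add list \<Rightarrow> ('v free_word \<Rightarrow>\<^sub>0 'f) set" where
  "wedge scale vs =
     foldr (\<otimes>\<^bsub>exterior_algebra scale\<^esub>) (map (\<lambda>v. exterior_class scale (free_gen v)) vs)
       \<one>\<^bsub>exterior_algebra scale\<^esub>"


section \<open>The Hodge star\<close>

definition linear_endo :: "('f::field, 'e, 'm) module_scheme \<Rightarrow> ('e \<Rightarrow> 'e) \<Rightarrow> bool" where
  "linear_endo M T \<longleftrightarrow>
     T \<in> carrier M \<rightarrow> carrier M \<and>
     (\<forall>w\<in>carrier M. \<forall>z\<in>carrier M. T (w \<oplus>\<^bsub>M\<^esub> z) = T w \<oplus>\<^bsub>M\<^esub> T z) \<and>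
     (\<forall>c. \<forall>w\<in>carrier M. T (c \<odot>\<^bsub>M\<^esub> w) = c \<odot>\<^bsub>M\<^esub> T w)"

text \<open>The value of the star outside the carrier is fixed to make the description unique.\<close>

definition hodge_star ::
    "('f \<Rightarrow> 'v \<Rightarrow> 'v) \<Rightarrow> ('v \<Rightarrow> 'v \<Rightarrow> 'f) \<Rightarrow> nat \<Rightarrow> (nat \<Rightarrow> 'v) \<Rightarrow>
     ('v::ab_group_add free_word \<Rightarrow>\<^sub>0 'f::field) set \<Rightarrow> ('v free_word \<Rightarrow>\<^sub>0 'f) set" where
  "hodge_star scale g d x =
     (THE T. T \<in> extensional (carrier (exterior_algebra scale)) \<and>
        linear_endo (exterior_algebra scale) T \<and>
        (\<forall>n\<le>d. \<forall>p. p permutes {0..<d} \<longrightarrow>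
           T (wedge scale (map (\<lambda>k. x (p k)) [0..<n])) =
             of_int (sign p) \<odot>\<^bsub>exterior_algebra scale\<^esub>
               wedge scale (map (\<lambda>k. reciprocal_basis g d x (p k)) [n..<d])))"

definition same_up_to_sign ::
    "('f, 'e, 'm) module_scheme \<Rightarrow> ('e \<Rightarrow> 'e) \<Rightarrow> ('e \<Rightarrow> 'e) \<Rightarrow> bool" where
  "same_up_to_sign M S T \<longleftrightarrow>
     (\<forall>w\<in>carrier M. T w = S w) \<or> (\<forall>w\<in>carrier M. T w = \<ominus>\<^bsub>M\<^esub> S w)"

definition gram_det :: "('v \<Rightarrow> 'v \<Rightarrow> 'f::field) \<Rightarrow> nat \<Rightarrow> (nat \<Rightarrow> 'v) \<Rightarrow> 'f" where
  "gram_det g d x = det (mat d d (\<lambda>(i, j). g (x i) (x j)))"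

end

theory Submission
  imports Defs
begin

text \<open>
  The star of a basis can be written without reference to words in that basis. Every vector
  \<open>v\<close> acts on the exterior algebra by contraction, the antiderivation with value \<open>g v u\<close> on a vector
  \<open>u\<close>. Contractions depend linearly on the vector and square to zero, so they extend to a right action
  of the whole exterior algebra on itself. If \<open>\<omega>\<close> is the product of the reciprocal basis in its order, then
  contracting \<open>\<omega>\<close> along \<open>x\<^sub>1 \<and> \<dots> \<and> x\<^sub>n\<close> strips the first \<open>n\<close> reciprocal factors, and reordering
  \<open>\<omega>\<close> first gives the sign for an arbitrary permutation. Hence the star is \<open>w \<mapsto> \<omega> \<cdot> w\<close>, as proved in
  \<open>hodge_star_eq\<close>. Existence of the star is thereby obtained without knowing a basis of the exterior
  algebra; uniqueness needs only the spanning statement \<open>monomials_in_subspace\<close>.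

  For a second basis the volume \<open>\<omega>'\<close> is a multiple \<open>c \<omega>\<close>, since the top power is spanned by one element,
  and so the second star is \<open>c\<close> times the first. As \<open>\<omega>\<close> is not killed by nonzero scalars, the stars agree
  up to sign iff \<open>c = 1\<close> or \<open>c = - 1\<close>, that is, iff \<open>c\<^sup>2 = 1\<close> (\<open>same_up_to_sign_hodge_star\<close>).
  If \<open>A\<close> expresses the second basis in terms of the first, contracting both volumes along the second
  basis yields \<open>c * det A = 1\<close> by Laplace expansion (\<open>contract_along_det\<close>). The Gram matrices satisfy
  \<open>G' = A * G * A\<^sup>T\<close>, so \<open>det G = c\<^sup>2 * det G'\<close> (\<open>gram_det_reciprocal_volume\<close>), and as \<open>det G'\<close> is not zero,
  the Gram determinants agree iff \<open>c\<^sup>2 = 1\<close>.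

  All computations are done with representatives in the free algebra, modulo the ideal.
\<close>

section \<open>The free algebra\<close>

lemma ring_free_alg: "ring (ring_of_type_algebra :: 'a::ring_1 ring)"
proof -
  have "\<exists>y. x + y = 0" for x :: 'a
    using add.right_inverse by blast
  thus ?thesis
    unfolding ring_of_type_algebra_def using add.right_inverse
    by unfold_locales (auto simp: algebra_simps Units_def)
qed

definition monomial :: "'v list \<Rightarrow> ('v free_word \<Rightarrow>\<^sub>0 'f::field)" where
  "monomial vs = Poly_Mapping.single (Word vs) 1"

lemma monomial_mult: "monomial us * monomial vs = monomial (us @ vs)"
  by (simp add: monomial_def mult_single plus_free_word_def)

lemma monomial_Nil: "monomial [] = 1"
  by (simp add: monomial_def zero_free_word_def[symmetric])

lemma free_gen_eq_monomial: "free_gen v = monomial [v]"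
  by (simp add: free_gen_def monomial_def)

lemma single_eq_free_const_mult: "Poly_Mapping.single w c = free_const c * monomial (letters w)"
  by (simp add: free_const_def monomial_def mult_single)

lemma free_const_0 [simp]: "free_const 0 = 0" by (simp add: free_const_def)
lemma free_const_1 [simp]: "free_const 1 = 1" by (simp add: free_const_def)
lemma free_const_add: "free_const (c + e) = free_const c + free_const e"
  by (simp add: free_const_def single_add)
lemma free_const_minus: "free_const (- c) = - free_const c"
  by (simp add: free_const_def single_uminus)
lemma free_const_diff: "free_const (c - e) = free_const c - free_const e"
  by (simp add: free_const_def single_diff)
lemma free_const_mult: "free_const (c * e) = free_const c * free_const e"
  by (simp add: free_const_def mult_single)

lemma free_alg_induct [case_names zero monomial add]:
  assumes "P 0" "\<And>c us. P (free_const c * monomial us)" "\<And>a b. P a \<Longrightarrow> P b \<Longrightarrow> P (a + b)"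
  shows "P (a :: 'v free_word \<Rightarrow>\<^sub>0 'f::field)"
proof (induction a rule: Poly_Mapping.update_induct)
  case const
  show ?case by (fact assms)
next
  case (update f w c)
  have "Poly_Mapping.update w c f = f + Poly_Mapping.single w c"
    using update by (intro poly_mapping_eqI)
      (auto simp: lookup_update lookup_add lookup_single in_keys_iff when_def)
  then show ?case using update assms by (simp add: single_eq_free_const_mult)
qed

lemma free_const_commute: "a * free_const c = free_const c * a"
proof (induction a rule: free_alg_induct)
  case (monomial e us)
  then show ?case
    by (simp add: free_const_def monomial_def mult_single mult.commute)
qed (simp_all add: algebra_simps)

text \<open>
  The words form a basis of the free algebra; contractions, the grade involution and the contraction
  action are prescribed on it.
\<close>
definition lin_ext :: "('v list \<Rightarrow> 'b free_word \<Rightarrow>\<^sub>0 'f::field) \<Rightarrow> ('v free_word \<Rightarrow>\<^sub>0 'f) \<Rightarrow> 'b free_word \<Rightarrow>\<^sub>0 'f"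
  where "lin_ext F a = (\<Sum>w\<in>Poly_Mapping.keys a. free_const (Poly_Mapping.lookup a w) * F (letters w))"

lemma lin_ext_superset:
  assumes "finite A" "Poly_Mapping.keys a \<subseteq> A"
  shows "lin_ext F a = (\<Sum>w\<in>A. free_const (Poly_Mapping.lookup a w) * F (letters w))"
  unfolding lin_ext_def using assms
  by (intro sum.mono_neutral_left) (auto simp: in_keys_iff)

lemma lin_ext_add: "lin_ext F (a + b) = lin_ext F a + lin_ext F b"
proof -
  let ?A = "Poly_Mapping.keys a \<union> Poly_Mapping.keys b"
  have "Poly_Mapping.keys (a + b) \<subseteq> ?A" by (rule Poly_Mapping.keys_add)
  then show ?thesis
    by (simp add: lin_ext_superset[where A = ?A] lookup_add free_const_add sum.distrib distrib_right)
qed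

lemma lin_ext_0 [simp]: "lin_ext F 0 = 0"
  by (simp add: lin_ext_def)

lemma lin_ext_uminus: "lin_ext F (- a) = - lin_ext F a"
  using lin_ext_add[of F a "- a"] by (simp add: add_eq_0_iff)

lemma lin_ext_diff: "lin_ext F (a - b) = lin_ext F a - lin_ext F b"
  using lin_ext_add[of F a "- b"] by (simp add: lin_ext_uminus)

lemma lin_ext_const_monomial: "lin_ext F (free_const c * monomial us) = free_const c * F us"
  by (cases "c = 0") (simp_all add: lin_ext_def single_eq_free_const_mult[of "Word us", simplified, symmetric])

lemma lin_ext_monomial [simp]: "lin_ext F (monomial us) = F us"
  using lin_ext_const_monomial[of F 1 us] by simp

lemma lin_ext_const: "lin_ext F (free_const c * a) = free_const c * lin_ext F a"
  by (induction a rule: free_alg_induct)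
    (simp_all add: distrib_left lin_ext_add lin_ext_const_monomial
      mult.assoc[symmetric] free_const_mult[symmetric])

text \<open>
  The coefficient at the empty word is the augmentation of the free algebra. It is multiplicative
  because a concatenation is empty only if both factors are.
\<close>
lemma lookup_0_mult:
  "Poly_Mapping.lookup (a * b :: 'v free_word \<Rightarrow>\<^sub>0 'f::field) 0 = Poly_Mapping.lookup a 0 * Poly_Mapping.lookup b 0"
proof (induction a rule: free_alg_induct)
  case (monomial c us)
  show ?case
  proof (induction b rule: free_alg_induct)
    case (monomial e vs)
    show ?case
      by (auto simp: single_eq_free_const_mult[of "Word _", simplified, symmetric] mult_single lookup_single
           plus_free_word_def zero_free_word_def when_def)
  qed (simp_all add: distrib_left lookup_add)
qed (simp_all add: distrib_right lookup_add)

section \<open>The exterior ideal\<close>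

lemma ideal_exterior_ideal: "ideal (exterior_ideal scale) free_alg"
  unfolding exterior_ideal_def
  by (rule ring.genideal_ideal[OF ring_free_alg]) (simp add: ring_of_type_algebra_def)

lemma a_inv_free_alg: "\<ominus>\<^bsub>ring_of_type_algebra\<^esub> a = - (a :: 'a::ring_1)"
proof -
  interpret ring "ring_of_type_algebra :: 'a ring" by (rule ring_free_alg)
  show ?thesis
    by (rule minus_equality) (simp_all add: ring_of_type_algebra_def)
qed

text \<open>Subtraction need not be checked, since \<open>- a\<close> is the multiple \<open>(-1) * a\<close>.\<close>
lemma ideal_free_algI:
  fixes J :: "'a::ring_1 set"
  assumes "0 \<in> J" "\<And>a b. a \<in> J \<Longrightarrow> b \<in> J \<Longrightarrow> a + b \<in> J"
    "\<And>a r. a \<in> J \<Longrightarrow> r * a \<in> J" "\<And>a r. a \<in> J \<Longrightarrow> a * r \<in> J"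
  shows "ideal J ring_of_type_algebra"
proof (rule idealI[OF ring_free_alg])
  interpret ring "ring_of_type_algebra :: 'a ring" by (rule ring_free_alg)
  have neg: "- a \<in> J" if "a \<in> J" for a using assms(3)[OF that, of "-1"] by simp
  have inv: "inv\<^bsub>add_monoid ring_of_type_algebra\<^esub> a = - a" for a :: 'a
    using a_inv_free_alg[of a] by (simp add: a_inv_def)
  show "subgroup J (add_monoid ring_of_type_algebra)"
    using assms(1,2) neg inv
    by unfold_locales (auto simp: ring_of_type_algebra_def)
qed (use assms in \<open>auto simp: ring_of_type_algebra_def\<close>)

lemma
  shows ideal_0: "0 \<in> exterior_ideal scale"
    and ideal_add: "a \<in> exterior_ideal scale \<Longrightarrow> b \<in> exterior_ideal scale \<Longrightarrow> a + b \<in> exterior_ideal scale"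
    and ideal_mult_left: "a \<in> exterior_ideal scale \<Longrightarrow> r * a \<in> exterior_ideal scale"
    and ideal_mult_right: "a \<in> exterior_ideal scale \<Longrightarrow> a * r \<in> exterior_ideal scale"
proof -
  interpret ideal "exterior_ideal scale" free_alg by (rule ideal_exterior_ideal)
  show "0 \<in> exterior_ideal scale" using additive_subgroup.zero_closed[OF is_additive_subgroup] by (simp add: ring_of_type_algebra_def)
  show "a \<in> exterior_ideal scale \<Longrightarrow> b \<in> exterior_ideal scale \<Longrightarrow> a + b \<in> exterior_ideal scale"
    using additive_subgroup.a_closed[OF is_additive_subgroup, of a b] by (simp add: ring_of_type_algebra_def)
  show "a \<in> exterior_ideal scale \<Longrightarrow> r * a \<in> exterior_ideal scale"
    using I_l_closed[of a r] by (simp add: ring_of_type_algebra_def)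
  show "a \<in> exterior_ideal scale \<Longrightarrow> a * r \<in> exterior_ideal scale"
    using I_r_closed[of a r] by (simp add: ring_of_type_algebra_def)
qed

lemma ideal_uminus: "a \<in> exterior_ideal scale \<Longrightarrow> - a \<in> exterior_ideal scale"
  using ideal_mult_left[of a scale "-1"] by simp

lemma ideal_diff: "a \<in> exterior_ideal scale \<Longrightarrow> b \<in> exterior_ideal scale \<Longrightarrow> a - b \<in> exterior_ideal scale"
  using ideal_add[of a scale "-b"] ideal_uminus[of b scale] by simp

lemma exterior_relations_subset: "exterior_relations scale \<subseteq> exterior_ideal scale"
  unfolding exterior_ideal_def
  by (rule ring.genideal_self[OF ring_free_alg]) (simp add: ring_of_type_algebra_def)

lemma exterior_ideal_minimal:
  fixes J :: "('v::ab_group_add free_word \<Rightarrow>\<^sub>0 'f::field) set"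
  assumes "exterior_relations scale \<subseteq> J"
    and "0 \<in> J" "\<And>a b. a \<in> J \<Longrightarrow> b \<in> J \<Longrightarrow> a + b \<in> J"
    "\<And>a r. a \<in> J \<Longrightarrow> r * a \<in> J" "\<And>a r. a \<in> J \<Longrightarrow> a * r \<in> J"
  shows "exterior_ideal scale \<subseteq> J"
  unfolding exterior_ideal_def
  by (rule ring.genideal_minimal[OF ring_free_alg ideal_free_algI assms(1)]) (use assms in blast)+

text \<open>
  The relations have no constant term and the augmentation is multiplicative. Hence the
  exterior algebra is not trivial, the fact behind every argument below that a scalar is determined.
\<close>
lemma lookup_0_exterior_ideal:
  fixes a :: "'v::ab_group_add free_word \<Rightarrow>\<^sub>0 'f::field"
  assumes "a \<in> exterior_ideal scale"
  shows "Poly_Mapping.lookup a 0 = 0"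
proof -
  have "exterior_ideal scale \<subseteq> {a :: 'v free_word \<Rightarrow>\<^sub>0 'f. Poly_Mapping.lookup a 0 = 0}"
  proof (rule exterior_ideal_minimal)
    have "Poly_Mapping.lookup (free_gen v :: 'v free_word \<Rightarrow>\<^sub>0 'f) 0 = 0" for v
      by (simp add: free_gen_def lookup_single zero_free_word_def when_def)
    then show "exterior_relations scale \<subseteq> {a :: 'v free_word \<Rightarrow>\<^sub>0 'f. Poly_Mapping.lookup a 0 = 0}"
      unfolding exterior_relations_def by (auto simp: lookup_add lookup_minus lookup_0_mult)
  qed (auto simp: lookup_add lookup_0_mult)
  then show ?thesis using assms by auto
qed

section \<open>Computing with representatives\<close>

lemma exterior_class_eq_iff: "exterior_class scale a = exterior_class scale b \<longleftrightarrow> a - b \<in> exterior_ideal scale"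
proof -
  interpret ideal "exterior_ideal scale" free_alg by (rule ideal_exterior_ideal)
  have "exterior_class scale a = exterior_class scale b \<longleftrightarrow> a \<ominus>\<^bsub>free_alg\<^esub> b \<in> exterior_ideal scale"
    unfolding exterior_class_def
    using quotient_eq_iff_same_a_r_cos[OF ideal_exterior_ideal, of a b scale]
    by (auto simp: ring_of_type_algebra_def)
  then show ?thesis by (simp add: a_minus_def a_inv_free_alg) (simp add: ring_of_type_algebra_def)
qed

lemma carrier_exterior_algebra: "carrier (exterior_algebra scale) = range (exterior_class scale)"
  by (auto simp: exterior_algebra_def Let_def FactRing_def exterior_class_def A_RCOSETS_def' ring_of_type_algebra_def)

lemma exterior_class_add:
  "exterior_class scale a \<oplus>\<^bsub>exterior_algebra scale\<^esub> exterior_class scale b = exterior_class scale (a + b)"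
proof -
  interpret ideal "exterior_ideal scale" free_alg by (rule ideal_exterior_ideal)
  show ?thesis using a_rcos_sum[of a b]
    by (simp add: exterior_algebra_def Let_def FactRing_def exterior_class_def ring_of_type_algebra_def)
qed

lemma exterior_class_mult:
  "exterior_class scale a \<otimes>\<^bsub>exterior_algebra scale\<^esub> exterior_class scale b = exterior_class scale (a * b)"
proof -
  interpret ideal "exterior_ideal scale" free_alg by (rule ideal_exterior_ideal)
  show ?thesis using rcoset_mult_add[of a b]
    by (simp add: exterior_algebra_def Let_def FactRing_def exterior_class_def ring_of_type_algebra_def)
qed

lemma exterior_class_smult:
  "c \<odot>\<^bsub>exterior_algebra scale\<^esub> exterior_class scale b = exterior_class scale (free_const c * b)"
  using exterior_class_mult[of scale "free_const c" b] by (simp add: exterior_algebra_def Let_def)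

lemma exterior_class_one: "\<one>\<^bsub>exterior_algebra scale\<^esub> = exterior_class scale 1"
  by (simp add: exterior_algebra_def Let_def FactRing_def exterior_class_def ring_of_type_algebra_def)

text \<open>
  The additive inverse depends only on the carrier, the addition and the zero, which the module shares
  with the quotient ring.
\<close>
lemma exterior_class_uminus:
  fixes scale :: "'a::field \<Rightarrow> 'b \<Rightarrow> 'b::ab_group_add"
  shows
  "\<ominus>\<^bsub>exterior_algebra scale\<^esub> exterior_class scale a = exterior_class scale (- a)"
proof -
  interpret ideal "exterior_ideal scale" free_alg by (rule ideal_exterior_ideal)
  interpret Q: ring "free_alg Quot exterior_ideal scale" by (rule quotient_is_ring)
  have "\<ominus>\<^bsub>exterior_algebra scale\<^esub> w = \<ominus>\<^bsub>free_alg Quot exterior_ideal scale\<^esub> w" for w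
    by (simp add: a_inv_def m_inv_def exterior_algebra_def Let_def)
  also have "\<ominus>\<^bsub>free_alg Quot exterior_ideal scale\<^esub> exterior_class scale a = exterior_class scale (- a)"
  proof (rule Q.minus_equality)
    have "\<zero>\<^bsub>free_alg\<^esub> = (0 :: 'b free_word \<Rightarrow>\<^sub>0 'a)"
      by (simp add: ring_of_type_algebra_def)
    then have "exterior_class scale 0 = exterior_ideal scale"
      using a_coset_add_zero[OF a_subset] by (simp add: exterior_class_def)
    then show "exterior_class scale (- a) \<oplus>\<^bsub>free_alg Quot exterior_ideal scale\<^esub> exterior_class scale a
       = \<zero>\<^bsub>free_alg Quot exterior_ideal scale\<^esub>"
      using exterior_class_add[of scale "- a" a]
      by (simp add: exterior_algebra_def Let_def FactRing_def)
  qed (use carrier_exterior_algebra[of scale] in \<open>simp_all add: exterior_algebra_def Let_def\<close>)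
  finally show ?thesis .
qed

lemma wedge_eq_class: "wedge scale vs = exterior_class scale (monomial vs)"
proof (induction vs)
  case Nil then show ?case by (simp add: wedge_def exterior_class_one monomial_Nil)
next
  case (Cons v vs)
  then show ?case
    by (simp add: wedge_def free_gen_eq_monomial exterior_class_mult monomial_mult)
qed

section \<open>Contractions\<close>

text \<open>
  The contraction by \<open>v\<close> is the antiderivation of the free algebra sending a letter \<open>u\<close> to the scalar
  \<open>g v u\<close>; the clauses below are the signed Leibniz rule for splitting off the first letter.
\<close>
fun contract_list :: "('v \<Rightarrow> 'v \<Rightarrow> 'f::field) \<Rightarrow> 'v \<Rightarrow> 'v list \<Rightarrow> 'v free_word \<Rightarrow>\<^sub>0 'f" where
  "contract_list g v [] = 0"
| "contract_list g v (u # us) = free_const (g v u) * monomial us - monomial [u] * contract_list g v us"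

definition contract :: "('v \<Rightarrow> 'v \<Rightarrow> 'f::field) \<Rightarrow> 'v \<Rightarrow> ('v free_word \<Rightarrow>\<^sub>0 'f) \<Rightarrow> 'v free_word \<Rightarrow>\<^sub>0 'f" where
  "contract g v = lin_ext (contract_list g v)"

text \<open>The grade involution carries the sign in the Leibniz rule for contractions of arbitrary products.\<close>
definition grade_involution :: "('v free_word \<Rightarrow>\<^sub>0 'f::field) \<Rightarrow> 'v free_word \<Rightarrow>\<^sub>0 'f" where
  "grade_involution = lin_ext (\<lambda>us. free_const ((-1) ^ length us) * monomial us)"

text \<open>
  The right action of the free algebra on itself in which the letter \<open>v\<close> acts as contraction by \<open>v\<close>.
  The first letter acts first, so that contracting a word of reciprocal vectors along an initial
  segment of the dual word strips that segment without further signs.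
\<close>
definition contract_along :: "('v \<Rightarrow> 'v \<Rightarrow> 'f::field) \<Rightarrow> ('v free_word \<Rightarrow>\<^sub>0 'f) \<Rightarrow>
    ('v free_word \<Rightarrow>\<^sub>0 'f) \<Rightarrow> 'v free_word \<Rightarrow>\<^sub>0 'f" where
  "contract_along g a m = lin_ext (\<lambda>us. fold (contract g) us m) a"

lemma contract_0 [simp]: "contract g v 0 = 0"
  and contract_add: "contract g v (a + b) = contract g v a + contract g v b"
  and contract_diff: "contract g v (a - b) = contract g v a - contract g v b"
  and contract_const: "contract g v (free_const c * a) = free_const c * contract g v a"
  and contract_monomial_Nil [simp]: "contract g v (monomial []) = 0"
  and contract_1 [simp]: "contract g v 1 = 0"
  and contract_monomial_Cons: "contract g v (monomial (u # us)) =
        free_const (g v u) * monomial us - monomial [u] * contract g v (monomial us)"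
  using lin_ext_monomial[of "contract_list g v" "[]"]
  by (simp_all add: contract_def lin_ext_add lin_ext_diff lin_ext_const monomial_Nil)

lemma grade_involution_0 [simp]: "grade_involution 0 = 0"
  and grade_involution_add: "grade_involution (a + b) = grade_involution a + grade_involution b"
  and grade_involution_diff: "grade_involution (a - b) = grade_involution a - grade_involution b"
  and grade_involution_const: "grade_involution (free_const c * a) = free_const c * grade_involution a"
  and grade_involution_monomial: "grade_involution (monomial us) = free_const ((-1) ^ length us) * monomial us"
  by (simp_all add: grade_involution_def lin_ext_add lin_ext_diff lin_ext_const)

lemma free_const_mult_left_commute: "a * (free_const c * b) = free_const c * (a * b)"
  by (metis free_const_commute mult.assoc)

text \<open>As a rewrite rule the general form loops on nested scalars; these two instances terminate.\<close>
lemmas free_const_simps =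
  free_const_mult_left_commute[of "monomial us" for us]
  free_const_mult_left_commute[of "free_const e" for e]

lemma grade_involution_mult: "grade_involution (a * b) = grade_involution a * grade_involution b"
proof (induction a rule: free_alg_induct)
  case (monomial c us)
  show ?case
  proof (induction b rule: free_alg_induct)
    case (monomial e vs)
    show ?case
      by (simp add: grade_involution_const grade_involution_monomial monomial_mult
        mult.assoc free_const_simps power_add free_const_mult)
  qed (simp_all add: distrib_left grade_involution_add)
qed (simp_all add: distrib_right grade_involution_add)

lemma contract_mult:
  "contract g v (a * b) = contract g v a * b + grade_involution a * contract g v b"
proof (induction a rule: free_alg_induct)
  case (monomial c us)
  have "contract g v (monomial us * b) = contract g v (monomial us) * b + grade_involution (monomial us) * contract g v b"
  proof (induction b rule: free_alg_induct)
    case (monomial e vs)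
    have "contract g v (monomial us * monomial vs) =
      contract g v (monomial us) * monomial vs + grade_involution (monomial us) * contract g v (monomial vs)"
    proof (induction us)
      case (Cons u us)
      have "contract g v (monomial (u # us) * monomial vs) =
          free_const (g v u) * (monomial us * monomial vs) - monomial [u] * contract g v (monomial us * monomial vs)"
        by (simp add: monomial_mult contract_monomial_Cons)
      note contract_Cons = this
      have grade_Cons: "grade_involution (monomial (u # us)) = - (monomial [u] * grade_involution (monomial us))"
        by (simp add: grade_involution_monomial monomial_mult free_const_minus free_const_simps)
      show ?case
        unfolding contract_Cons grade_Cons Cons.IH contract_monomial_Cons[of g v u us]
        by (simp add: left_diff_distrib distrib_left mult.assoc)
    next
      case Nil
      have "grade_involution (monomial [] :: 'a free_word \<Rightarrow>\<^sub>0 'b) = 1"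
        by (simp add: grade_involution_monomial) (simp add: monomial_Nil)
      then show ?case by (simp add: monomial_Nil)
    qed
    then show ?case
      by (simp add: contract_const free_const_simps distrib_left
          free_const_mult_left_commute[of "contract g v (monomial us)"]
          free_const_mult_left_commute[of "grade_involution (monomial us)"])
  qed (simp_all add: distrib_left contract_add)
  then show ?case
    by (simp add: mult.assoc contract_const grade_involution_const distrib_left)
qed (simp_all add: distrib_right contract_add grade_involution_add)

lemma contract_letter_mult:
  "contract g v (monomial [u] * a) = free_const (g v u) * a - monomial [u] * contract g v a"
  by (simp add: contract_mult contract_monomial_Cons grade_involution_monomial free_const_minus monomial_Nil left_diff_distrib mult.assoc)

text \<open>
  Squares of contractions vanish in the free algebra itself, so the relation \<open>v \<otimes> v = 0\<close>
  holds for the action on the nose.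
\<close>
lemma contract_contract [simp]: "contract g v (contract g v a) = 0"
proof (induction a rule: free_alg_induct)
  case (monomial c us)
  have "contract g v (contract g v (monomial us)) = 0"
    by (induction us)
      (simp_all add: contract_monomial_Cons contract_diff contract_const contract_letter_mult)
  then show ?case by (simp add: contract_const)
qed (simp_all add: contract_add)

lemma contract_along_0_left [simp]: "contract_along g 0 m = 0"
  and contract_along_add_left: "contract_along g (a + b) m = contract_along g a m + contract_along g b m"
  and contract_along_diff_left: "contract_along g (a - b) m = contract_along g a m - contract_along g b m"
  and contract_along_const_left: "contract_along g (free_const c * a) m = free_const c * contract_along g a m"
  and contract_along_monomial_Nil [simp]: "contract_along g (monomial []) m = m"
  and contract_along_monomial_Cons:
    "contract_along g (monomial (v # vs)) m = contract_along g (monomial vs) (contract g v m)"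
  and contract_along_monomial: "contract_along g (monomial vs) m = fold (contract g) vs m"
  by (simp_all add: contract_along_def lin_ext_add lin_ext_diff lin_ext_const)

lemma contract_along_1 [simp]: "contract_along g 1 m = m"
  using contract_along_monomial_Nil[of g m] by (simp only: monomial_Nil)

lemma contract_along_free_const: "contract_along g (free_const c) m = free_const c * m"
  using contract_along_const_left[of g c 1 m] by simp

lemma contract_along_0_right [simp]: "contract_along g a 0 = 0"
proof (induction a rule: free_alg_induct)
  case (monomial c us)
  have "fold (contract g) us 0 = 0" by (induction us) simp_all
  then show ?case by (simp add: contract_along_const_left contract_along_monomial)
qed (simp_all add: contract_along_add_left)

lemma contract_along_add_right: "contract_along g a (m + n) = contract_along g a m + contract_along g a n"
proof (induction a rule: free_alg_induct)
  case (monomial c us)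
  have "fold (contract g) us (m + n) = fold (contract g) us m + fold (contract g) us n"
    by (induction us arbitrary: m n) (simp_all add: contract_add)
  then show ?case by (simp add: contract_along_const_left contract_along_monomial distrib_left)
qed (simp_all add: contract_along_add_left)

lemma contract_along_const_right: "contract_along g a (free_const c * m) = free_const c * contract_along g a m"
proof (induction a rule: free_alg_induct)
  case (monomial e us)
  have "fold (contract g) us (free_const c * m) = free_const c * fold (contract g) us m"
    by (induction us arbitrary: m) (simp_all add: contract_const)
  then show ?case
    by (simp add: contract_along_const_left contract_along_monomial free_const_simps)
qed (simp_all add: contract_along_add_left distrib_left)

lemma contract_along_diff_right: "contract_along g a (m - n) = contract_along g a m - contract_along g a n"
  using contract_along_add_right[of g a "m - n" n] by (simp add: algebra_simps)

lemma contract_along_mult: "contract_along g (a * b) m = contract_along g b (contract_along g a m)"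
proof (induction a rule: free_alg_induct)
  case (monomial c us)
  show ?case
  proof (induction b rule: free_alg_induct)
    case (monomial e vs)
    show ?case
      by (simp add: mult.assoc free_const_simps monomial_mult contract_along_const_left
        contract_along_const_right contract_along_monomial)
  qed (simp_all add: distrib_left contract_along_add_left)
qed (simp_all add: distrib_right contract_along_add_left contract_along_add_right)

lemma contract_along_free_gen [simp]: "contract_along g (free_gen v) m = contract g v m"
  by (simp add: free_gen_eq_monomial contract_along_monomial)

lemma exterior_relation_cases:
  assumes "r \<in> exterior_relations scale"
  obtains (add) u v where "r = free_gen (u + v) - (free_gen u + free_gen v)"
  | (scale) c v where "r = free_gen (scale c v) - free_const c * free_gen v"
  | (square) v where "r = free_gen v * free_gen v"
  using assms unfolding exterior_relations_def by blast

context scalar_product_space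
begin

lemma g_add_left: "g (u + v) w = g u w + g v w"
  and g_scale_left: "g (scale c v) w = c * g v w"
  and g_add_right: "g w (u + v) = g w u + g w v"
  and g_scale_right: "g w (scale c v) = c * g w v"
proof -
  interpret l: Vector_Spaces.linear scale "(*)" "\<lambda>u. g u w" by (rule linear_left)
  interpret r: Vector_Spaces.linear scale "(*)" "\<lambda>u. g w u" by (rule linear_right)
  show "g (u + v) w = g u w + g v w" "g (scale c v) w = c * g v w"
    by (rule l.add l.scale)+
  show "g w (u + v) = g w u + g w v" "g w (scale c v) = c * g w v"
    by (rule r.add r.scale)+
qed

text \<open>
  Contractions annihilate all defining relations; for \<open>v \<otimes> v\<close> the two terms \<open>g w v \<cdot> v\<close> cancel because
  scalars are central. The Leibniz rule propagates this to the ideal, provided stability under the grade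
  involution is carried along in the induction.
\<close>
lemma contract_exterior_ideal:
  assumes "a \<in> exterior_ideal scale"
  shows "contract g v a \<in> exterior_ideal scale"
proof -
  let ?I = "exterior_ideal scale"
  let ?J = "{a \<in> ?I. grade_involution a \<in> ?I \<and> (\<forall>v. contract g v a \<in> ?I)}"
  have "?I \<subseteq> ?J"
  proof (rule exterior_ideal_minimal)
    show "exterior_relations scale \<subseteq> ?J"
    proof
      fix r assume r: "r \<in> exterior_relations scale"
      then have rI: "r \<in> ?I" using exterior_relations_subset by blast
      from r have "(grade_involution r = - r \<or> grade_involution r = r) \<and> (\<forall>v. contract g v r = 0)"
      proof (cases rule: exterior_relation_cases)
        case (add u v)
        show ?thesis
          unfolding add
          by (simp add: free_gen_eq_monomial grade_involution_diff grade_involution_add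
            grade_involution_monomial contract_diff contract_add contract_monomial_Cons g_add_right
            free_const_add free_const_minus monomial_Nil algebra_simps)
      next
        case (scale c v)
        show ?thesis
          unfolding scale
          by (simp add: free_gen_eq_monomial grade_involution_diff grade_involution_const
            grade_involution_monomial contract_diff contract_const contract_monomial_Cons g_scale_right
            free_const_mult free_const_minus monomial_Nil algebra_simps)
      next
        case (square v)
        then show ?thesis
          by (simp add: free_gen_eq_monomial monomial_mult 
            grade_involution_monomial contract_monomial_Cons monomial_Nil free_const_commute[of "monomial [v]"])
      qed
      then show "r \<in> ?J" using rI ideal_uminus[OF rI] ideal_0[of scale] by auto
    qed
  qed (auto simp: ideal_0 ideal_add ideal_mult_left ideal_mult_right contract_add contract_mult
        grade_involution_add grade_involution_mult)
  then show ?thesis using assms by auto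
qed

lemma contract_along_exterior_ideal_right:
  assumes "m \<in> exterior_ideal scale"
  shows "contract_along g a m \<in> exterior_ideal scale"
proof (induction a rule: free_alg_induct)
  case (monomial c us)
  have "fold (contract g) us m \<in> exterior_ideal scale" using assms
    by (induction us arbitrary: m) (simp_all add: contract_exterior_ideal)
  then show ?case
    by (simp add: contract_along_const_left contract_along_monomial ideal_mult_left)
qed (simp_all add: contract_along_add_left ideal_0 ideal_add)

lemma
  shows contract_add_left: "contract g (u + v) a = contract g u a + contract g v a"
    and contract_scale_left: "contract g (scale c v) a = free_const c * contract g v a"
proof -
  have "contract g (u + v) (monomial us) = contract g u (monomial us) + contract g v (monomial us)" for us
    by (induction us) (simp_all add: contract_monomial_Cons g_add_left free_const_add algebra_simps)
  then show "contract g (u + v) a = contract g u a + contract g v a"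
    by (induction a rule: free_alg_induct) (simp_all add: contract_add contract_const distrib_left)
  have "contract g (scale c v) (monomial us) = free_const c * contract g v (monomial us)" for us
    by (induction us) (simp_all add: contract_monomial_Cons g_scale_left free_const_mult
      right_diff_distrib mult.assoc free_const_simps)
  then show "contract g (scale c v) a = free_const c * contract g v a"
    by (induction a rule: free_alg_induct)
      (simp_all add: contract_add contract_const distrib_left free_const_simps)
qed

text \<open>
  By the universal property of the exterior algebra: contractions depend linearly on the vector and
  square to zero, so the action factors through the quotient.
\<close>
lemma contract_along_exterior_ideal_left:
  assumes "a \<in> exterior_ideal scale"
  shows "contract_along g a m = 0"
proof -
  let ?J = "{a. \<forall>m. contract_along g a m = 0}"
  have "exterior_ideal scale \<subseteq> ?J"
  proof (rule exterior_ideal_minimal)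
    show "exterior_relations scale \<subseteq> ?J"
    proof
      fix r assume "r \<in> exterior_relations scale"
      then show "r \<in> ?J"
        by (cases rule: exterior_relation_cases)
          (simp_all add: contract_along_diff_left contract_along_add_left contract_along_const_left
            contract_along_mult contract_along_free_const contract_const contract_add_left contract_scale_left)
    qed
  qed (auto simp: contract_along_add_left contract_along_mult)
  then show ?thesis using assms by auto
qed

end

section \<open>Skew-symmetry and spanning families\<close>

lemma monomial_split: "monomial (us @ vs @ ws) = monomial us * monomial vs * monomial ws"
  by (simp add: monomial_mult)

lemma monomial_slot_add:
  "monomial (us @ [u + v] @ ws) - (monomial (us @ [u] @ ws) + monomial (us @ [v] @ ws)) \<in> exterior_ideal scale"
proof -
  have "free_gen (u + v) - (free_gen u + free_gen v) \<in> exterior_ideal scale"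
    using exterior_relations_subset unfolding exterior_relations_def by blast
  then have "monomial us * (free_gen (u + v) - (free_gen u + free_gen v)) * monomial ws \<in> exterior_ideal scale"
    by (intro ideal_mult_left ideal_mult_right)
  then show ?thesis
    by (simp only: monomial_split free_gen_eq_monomial) (simp add: algebra_simps)
qed

lemma monomial_slot_scale:
  "monomial (us @ [scale c v] @ ws) - free_const c * monomial (us @ [v] @ ws) \<in> exterior_ideal scale"
proof -
  have "free_gen (scale c v) - free_const c * free_gen v \<in> exterior_ideal scale"
    using exterior_relations_subset unfolding exterior_relations_def by blast
  then have "monomial us * (free_gen (scale c v) - free_const c * free_gen v) * monomial ws \<in> exterior_ideal scale"
    by (intro ideal_mult_left ideal_mult_right)
  then show ?thesis
    by (simp only: monomial_split free_gen_eq_monomial)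
      (simp add: left_diff_distrib right_diff_distrib free_const_mult_left_commute mult.assoc)
qed

lemma monomial_slot_square: "monomial (us @ [v, v] @ ws) \<in> exterior_ideal scale"
proof -
  have "free_gen v * free_gen v \<in> exterior_ideal scale"
    using exterior_relations_subset unfolding exterior_relations_def by blast
  then have "monomial us * (free_gen v * free_gen v) * monomial ws \<in> exterior_ideal scale"
    by (rule ideal_mult_right[OF ideal_mult_left])
  then show ?thesis by (simp add: free_gen_eq_monomial monomial_mult)
qed

text \<open>
  Polarization: expand the word with \<open>u + v\<close> in both positions. The vanishing for repeated letters is
  a hypothesis here because its proof needs the case of adjacent letters of this lemma.
\<close>
lemma monomial_swap_if_repeated:
  fixes scale :: "'f::field \<Rightarrow> 'v::ab_group_add \<Rightarrow> 'v"
  assumes rep: "\<And>w. monomial (us @ [w] @ ws @ [w] @ zs) \<in> exterior_ideal scale"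
  shows "monomial (us @ [u] @ ws @ [v] @ zs) + monomial (us @ [v] @ ws @ [u] @ zs) \<in> exterior_ideal scale"
proof -
  define M where "M u v = (monomial (us @ [u] @ ws @ [v] @ zs) :: 'v free_word \<Rightarrow>\<^sub>0 'f)" for u v
  have l: "M (u + v) w - (M u w + M v w) \<in> exterior_ideal scale" for w
    unfolding M_def by (rule monomial_slot_add)
  have r: "M w (u + v) - (M w u + M w v) \<in> exterior_ideal scale" for w
    using monomial_slot_add[of "us @ [w] @ ws" u v zs scale] by (simp add: M_def)
  have d: "M w w \<in> exterior_ideal scale" for w
    using rep by (simp add: M_def)
  have "M u v + M v u = M (u + v) (u + v) - (M (u + v) (u + v) - (M u (u + v) + M v (u + v)))
      - (M u (u + v) - (M u u + M u v)) - (M v (u + v) - (M v u + M v v)) - M u u - M v v"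
    by (simp add: algebra_simps)
  then have "M u v + M v u \<in> exterior_ideal scale"
    using ideal_diff d l r by metis
  then show ?thesis by (simp add: M_def)
qed

text \<open>The left one of the two equal letters is moved to the right by adjacent swaps until they meet.\<close>
lemma monomial_repeated: "monomial (us @ [v] @ ws @ [v] @ zs) \<in> exterior_ideal scale"
proof (induction ws arbitrary: us)
  case Nil
  then show ?case using monomial_slot_square[of us v zs scale] by simp
next
  case (Cons w ws)
  have "monomial (us @ [v] @ [] @ [w] @ ws @ [v] @ zs) + monomial (us @ [w] @ [] @ [v] @ ws @ [v] @ zs) \<in> exterior_ideal scale"
    using monomial_slot_square[of us _ "ws @ [v] @ zs" scale] by (intro monomial_swap_if_repeated) simp
  moreover have "monomial (us @ [w] @ [v] @ ws @ [v] @ zs) \<in> exterior_ideal scale"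
    using Cons.IH[of "us @ [w]"] by simp
  ultimately have "monomial (us @ [v] @ [w] @ ws @ [v] @ zs) + monomial (us @ [w] @ [v] @ ws @ [v] @ zs)
      - monomial (us @ [w] @ [v] @ ws @ [v] @ zs) \<in> exterior_ideal scale"
    by (intro ideal_diff) simp_all
  then show ?case by simp
qed

lemma monomial_not_distinct:
  assumes "\<not> distinct vs"
  shows "monomial vs \<in> exterior_ideal scale"
  using not_distinct_decomp[OF assms] monomial_repeated by metis

lemma monomial_swap:
  "monomial (us @ [u] @ ws @ [v] @ zs) + monomial (us @ [v] @ ws @ [u] @ zs) \<in> exterior_ideal scale"
  by (rule monomial_swap_if_repeated) (rule monomial_repeated)

lemma monomial_transpose_less:
  assumes "a < b" "b < d"
  shows "monomial (map (z \<circ> transpose a b) [0..<d]) + monomial (map z [0..<d]) \<in> exterior_ideal scale"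
proof -
  have split: "[0..<d] = [0..<a] @ [a] @ [Suc a..<b] @ [b] @ [Suc b..<d]"
    using assms upt_add_eq_append[of 0 a "d - a"] upt_add_eq_append[of "Suc a" b "d - b"]
    by (simp add: upt_conv_Cons)
  have *: "map (z \<circ> transpose a b) xs = map z xs" if "a \<notin> set xs" "b \<notin> set xs" for xs
    using that by (auto simp: transpose_def)
  have "map (z \<circ> transpose a b) [0..<d] =
      map z [0..<a] @ [z b] @ map z [Suc a..<b] @ [z a] @ map z [Suc b..<d]"
    unfolding split map_append using assms by (simp add: *)
  moreover have "map z [0..<d] = map z [0..<a] @ [z a] @ map z [Suc a..<b] @ [z b] @ map z [Suc b..<d]"
    unfolding split by simp
  ultimately show ?thesis using monomial_swap by metis
qed

lemma monomial_transpose: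
  assumes "a < d" "b < d" "a \<noteq> b"
  shows "monomial (map (z \<circ> transpose a b) [0..<d]) + monomial (map z [0..<d]) \<in> exterior_ideal scale"
  using assms monomial_transpose_less[of a b d z scale] monomial_transpose_less[of b a d z scale]
  by (cases "a < b") (simp_all add: transpose_commute)

lemma monomial_permute:
  fixes scale :: "'f::field \<Rightarrow> 'v::ab_group_add \<Rightarrow> 'v"
  assumes "p permutes {0..<d}"
  shows "monomial (map (\<lambda>k. z (p k)) [0..<d]) - free_const (of_int (sign p)) * monomial (map z [0..<d])
    \<in> exterior_ideal scale"
proof -
  have "finite {0..<d}" by simp
  from assms this show ?thesis
  proof (induction p arbitrary: z rule: permutes_induct)
    case id
    show ?case using ideal_0[of scale] by (simp add: sign_id)
  next
    case (swap a b p)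
    let ?I = "exterior_ideal scale"
    have "monomial (map (\<lambda>k. (z \<circ> transpose a b) (p k)) [0..<d]) -
        free_const (of_int (sign p)) * monomial (map (z \<circ> transpose a b) [0..<d]) \<in> ?I"
      by (rule swap.IH)
    moreover have "free_const (of_int (sign p)) *
       (monomial (map (z \<circ> transpose a b) [0..<d]) + monomial (map z [0..<d])) \<in> ?I"
      using swap by (intro ideal_mult_left monomial_transpose) auto
    ultimately have "monomial (map (\<lambda>k. (z \<circ> transpose a b) (p k)) [0..<d]) +
       free_const (of_int (sign p)) * monomial (map z [0..<d]) \<in> ?I"
      using ideal_add by (fastforce simp: algebra_simps)
    moreover have "sign (transpose a b \<circ> p) = - sign p"
      using swap permutes_imp_permutation[of "{0..<d}" p]
      by (simp add: sign_compose permutation_swap_id sign_swap_id)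
    ultimately show ?case by (simp add: free_const_minus comp_def)
  qed
qed

text \<open>The missing indices, in increasing order, complete the list to an enumeration of all of them.\<close>
lemma obtain_permutation_extending:
  assumes "distinct js" "set js \<subseteq> {0..<d}"
  obtains p where "p permutes {0..<d}" "map p [0..<length js] = js"
proof -
  define l where "l = js @ filter (\<lambda>i. i \<notin> set js) [0..<d]"
  define p where "p i = (if i < d then l ! i else i)" for i
  have l: "distinct l" "set l = {0..<d}"
    using assms by (auto simp: l_def)
  then have len: "length l = d" using distinct_card[OF l(1)] by simp
  have "bij_betw ((!) l) {0..<d} {0..<d}"
    using bij_betw_nth[OF l(1)] l len by (simp add: atLeast0LessThan)
  then have "bij_betw p {0..<d} {0..<d}"
    by (subst bij_betw_cong[where g = "(!) l"]) (simp_all add: p_def)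
  then have "p permutes {0..<d}"
    by (rule bij_imp_permutes) (simp add: p_def)
  moreover have "length js \<le> d" using len by (simp add: l_def)
  then have "map p [0..<length js] = js"
    by (intro nth_equalityI) (auto simp: p_def l_def nth_append)
  ultimately show thesis by (rule that)
qed

text \<open>
  The exterior power is spanned by the words without repetition in a spanning family: expanding the
  letters one at a time from the right reduces an arbitrary word to words in the family, and words
  with a repeated letter lie in the ideal. Of interest are two subspaces \<open>K\<close>: the equalizer of two linear
  maps, and the multiples, modulo the ideal, of a word of length \<open>d\<close>.
\<close>
lemma monomials_in_subspace:
  fixes scale :: "'f::field \<Rightarrow> 'v::ab_group_add \<Rightarrow> 'v"
  assumes "vector_space scale"
    and ideal: "exterior_ideal scale \<subseteq> K"
    and add: "\<And>a b. a \<in> K \<Longrightarrow> b \<in> K \<Longrightarrow> a + b \<in> K"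
    and const: "\<And>c a. a \<in> K \<Longrightarrow> free_const c * a \<in> K"
    and spanning: "\<And>v. \<exists>a. v = (\<Sum>j<d. scale (a j) (y j))"
    and perm: "\<And>p. p permutes {0..<d} \<Longrightarrow> n \<le> d \<Longrightarrow> monomial (map (\<lambda>k. y (p k)) [0..<n]) \<in> K"
    and "length us = n"
  shows "monomial us \<in> K"
proof -
  interpret vector_space scale by fact
  have cong: "a \<in> K" if "a - b \<in> exterior_ideal scale" "b \<in> K" for a b
    using add[of "a - b" b] that ideal by auto
  have slot: "monomial (us @ [\<Sum>j\<in>A. scale (a j) (y j)] @ ws) \<in> K"
    if "finite A" "\<And>j. j \<in> A \<Longrightarrow> monomial (us @ [y j] @ ws) \<in> K" for us ws a A
    using that
  proof (induction A rule: finite_induct)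
    case empty
    have "monomial (us @ [scale 0 0] @ ws) - free_const 0 * monomial (us @ [0] @ ws) \<in> exterior_ideal scale"
      by (rule monomial_slot_scale)
    then show ?case using ideal by auto
  next
    case (insert i A)
    have "monomial (us @ [scale (a i) (y i)] @ ws) \<in> K"
      using insert.prems by (intro cong[OF monomial_slot_scale] const) auto
    with insert have "monomial (us @ [scale (a i) (y i)] @ ws) +
        monomial (us @ [\<Sum>j\<in>A. scale (a j) (y j)] @ ws) \<in> K"
      by (intro add) auto
    from cong[OF monomial_slot_add this] show ?case using insert by simp
  qed
  have basis: "monomial (map y js) \<in> K" if js: "length js = n" "set js \<subseteq> {0..<d}" for js
  proof (cases "distinct js")
    case True
    obtain p where p: "p permutes {0..<d}" "map p [0..<length js] = js"
      using obtain_permutation_extending[OF True js(2)] by blast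
    have "length js \<le> d"
      using True js card_mono[of "{0..<d}" "set js"] distinct_card[OF True] by simp
    with perm[OF p(1)] have "monomial (map y (map p [0..<length js])) \<in> K"
      using js(1) by (simp add: comp_def)
    then show ?thesis by (simp only: p(2))
  next
    case False
    then have "\<not> distinct (map y js)" using distinct_map by blast
    then show ?thesis using monomial_not_distinct ideal by blast
  qed
  have "monomial (us @ map y js) \<in> K" if "length us + length js = n" "set js \<subseteq> {0..<d}" for js
    using that
  proof (induction us arbitrary: js rule: rev_induct)
    case Nil
    then show ?case using basis by simp
  next
    case (snoc v us)
    obtain a where v: "v = (\<Sum>j<d. scale (a j) (y j))" using spanning by blast
    have "monomial (us @ [v] @ map y js) \<in> K"
      unfolding v
    proof (rule slot)
      fix j assume "j \<in> {..<d}"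
      then show "monomial (us @ [y j] @ map y js) \<in> K"
        using snoc.IH[of "j # js"] snoc.prems by simp
    qed simp
    then show ?case by simp
  qed
  from this[of "[]"] show ?thesis using assms(7) by simp
qed

section \<open>Contractions and determinants\<close>

lemma contract_monomial_expand:
  "contract g v (monomial us) =
     (\<Sum>j<length us. free_const ((-1) ^ j * g v (us ! j)) * monomial (take j us @ drop (Suc j) us))"
proof (induction us)
  case (Cons u us)
  have "monomial [u] * contract g v (monomial us) = 
    (\<Sum>j<length us. free_const ((-1) ^ j * g v (us ! j)) * monomial (u # take j us @ drop (Suc j) us))"
    by (simp add: Cons.IH sum_distrib_left free_const_mult_left_commute monomial_mult)
  then show ?case
    by (simp add: contract_monomial_Cons sum.lessThan_Suc_shift free_const_minus sum_negf del: sum.lessThan_Suc)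
qed simp

lemma contract_monomial_orthogonal:
  assumes "\<And>u. u \<in> set us \<Longrightarrow> g v u = 0"
  shows "contract g v (monomial us) = 0"
  using assms by (simp add: contract_monomial_expand)

lemma contract_along_sum_right: "contract_along g a (\<Sum>j\<in>A. f j) = (\<Sum>j\<in>A. contract_along g a (f j))"
  by (induction A rule: infinite_finite_induct) (simp_all add: contract_along_add_right)

text \<open>
  Contracting by the first letter is the Laplace expansion along the first row. No correction from
  the ideal occurs, because the result has degree zero.
\<close>
lemma contract_along_det:
  assumes "length us = n" "length vs = n"
  shows "contract_along g (monomial us) (monomial vs) = free_const (det (mat n n (\<lambda>(i, j). g (us ! i) (vs ! j))))"
  using assms
proof (induction us arbitrary: n vs)
  case Nil
  then show ?case by (simp add: monomial_Nil)
next
  case (Cons u us)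
  define m where "m = length us"
  define A where "A = mat n n (\<lambda>(i, j). g ((u # us) ! i) (vs ! j))"
  have n: "n = Suc m" using Cons.prems by (simp add: m_def)
  have "contract_along g (monomial us) (monomial (take j vs @ drop (Suc j) vs)) = free_const (det (mat_delete A 0 j))"
    if "j < n" for j
  proof -
    have "length (take j vs @ drop (Suc j) vs) = m" using that Cons.prems n by simp
    moreover have "mat m m (\<lambda>(i, k). g (us ! i) ((take j vs @ drop (Suc j) vs) ! k)) = mat_delete A 0 j"
      using that Cons.prems n by (intro eq_matI) (auto simp: A_def mat_delete_def nth_append min_def)
    ultimately show ?thesis using Cons.IH[of m "take j vs @ drop (Suc j) vs"] m_def by simp
  qed
  then have "contract_along g (monomial (u # us)) (monomial vs) =
      (\<Sum>j<n. free_const ((-1) ^ j * g u (vs ! j)) * free_const (det (mat_delete A 0 j)))"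
    using Cons.prems by (simp add: contract_along_monomial_Cons contract_monomial_expand
        contract_along_sum_right contract_along_const_right)
  also have "\<dots> = (\<Sum>j<n. free_const (A $$ (0, j) * cofactor A 0 j))"
    using n by (intro sum.cong) (auto simp: A_def cofactor_def free_const_mult[symmetric] mult_ac)
  also have "\<dots> = free_const (\<Sum>j<n. A $$ (0, j) * cofactor A 0 j)"
    by (induction n) (simp_all add: free_const_add)
  also have "(\<Sum>j<n. A $$ (0, j) * cofactor A 0 j) = det A"
    using n by (intro laplace_expansion_row[symmetric]) (auto simp: A_def)
  finally show ?case by (simp only: A_def)
qed

section \<open>Reciprocal bases\<close>

text \<open>
  Fixing this representative in the free algebra, rather than its class, lets the exact identities
  for contractions of words be used.
\<close>

definition reciprocal_volume :: "('v \<Rightarrow> 'v \<Rightarrow> 'f::field) \<Rightarrow> nat \<Rightarrow> (nat \<Rightarrow> 'v) \<Rightarrow> 'v free_word \<Rightarrow>\<^sub>0 'f" where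
  "reciprocal_volume g d x = monomial (map (reciprocal_basis g d x) [0..<d])"

context scalar_product_space
begin

lemma g_0_left [simp]: "g 0 w = 0" and g_0_right [simp]: "g w 0 = 0"
  using g_scale_left[of 0 0 w] g_scale_right[of w 0 0] by simp_all

lemma g_sum_left: "g (\<Sum>j\<in>A. f j) w = (\<Sum>j\<in>A. g (f j) w)"
  by (induction A rule: infinite_finite_induct) (simp_all add: g_add_left)

lemma g_sum_right: "g w (\<Sum>j\<in>A. f j) = (\<Sum>j\<in>A. g w (f j))"
  by (induction A rule: infinite_finite_induct) (simp_all add: g_add_right)

lemma g_diff_left: "g (u - v) w = g u w - g v w"
  using g_add_left[of "u - v" v w] by simp

lemma ordered_basis_expand:
  assumes "ordered_basis d x"
  obtains a where "v = (\<Sum>j<d. scale (a j) (x j))"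
proof -
  from assms have x: "inj_on x {0..<d}" "span (x ` {0..<d}) = UNIV"
    by (auto simp: ordered_basis_def)
  have "v \<in> span (x ` {0..<d})" using x by simp
  then obtain u where "v = (\<Sum>w\<in>x ` {0..<d}. scale (u w) w)"
    by (auto simp: span_finite)
  also have "\<dots> = (\<Sum>j<d. scale (u (x j)) (x j))"
    using x by (simp add: sum.reindex atLeast0LessThan)
  finally show thesis by (rule that)
qed

lemma ordered_basis_coefficients_0:
  assumes "ordered_basis d x" "(\<Sum>j<d. scale (a j) (x j)) = 0" "i < d"
  shows "a i = 0"
proof -
  from assms(1) have x: "inj_on x {0..<d}" "independent (x ` {0..<d})"
    by (auto simp: ordered_basis_def)
  define u where "u w = a (inv_into {0..<d} x w)" for w
  have u: "u (x j) = a j" if "j < d" for j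
    using that x(1) by (simp add: u_def inv_into_f_f)
  have "(\<Sum>w\<in>x ` {0..<d}. scale (u w) w) = (\<Sum>j<d. scale (u (x j)) (x j))"
    using x by (simp add: sum.reindex atLeast0LessThan)
  also have "\<dots> = 0" using assms(2) u by simp
  finally have "u (x i) = 0"
    using x(2) assms(3) by (intro independentD[of "x ` {0..<d}" "x ` {0..<d}" u]) auto
  then show ?thesis using u assms(3) by simp
qed

lemma ordered_basis_orthogonal_0:
  assumes "ordered_basis d x" "\<And>j. j < d \<Longrightarrow> g u (x j) = 0"
  shows "u = 0"
proof (rule nondegenerate)
  fix v
  obtain a where "v = (\<Sum>j<d. scale (a j) (x j))" using ordered_basis_expand[OF assms(1)] .
  then show "g u v = 0" using assms(2) by (simp add: g_sum_right g_scale_right)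
qed

text \<open>A vector in the kernel of the Gram matrix would give a vector orthogonal to the whole basis.\<close>
lemma gram_det_nonzero:
  assumes "ordered_basis d x"
  shows "gram_det g d x \<noteq> 0"
proof
  define G where "G = mat d d (\<lambda>(i, j). g (x i) (x j))"
  have G: "G \<in> carrier_mat d d" by (simp add: G_def)
  assume "gram_det g d x = 0"
  then have "det G = 0" by (simp add: gram_det_def G_def)
  then obtain v where v: "v \<in> carrier_vec d" "v \<noteq> 0\<^sub>v d" "G *\<^sub>v v = 0\<^sub>v d"
    using det_0_iff_vec_prod_zero_field[OF G] by blast
  define u where "u = (\<Sum>j<d. scale (v $ j) (x j))"
  have "g u (x i) = 0" if "i < d" for i
  proof -
    have "(G *\<^sub>v v) $ i = (\<Sum>j<d. g (x i) (x j) * v $ j)"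
      using that v(1) by (simp add: G_def scalar_prod_def atLeast0LessThan)
    also have "\<dots> = g u (x i)"
      by (simp add: u_def g_sum_left g_scale_left symmetric[of "x i"] mult.commute)
    finally show ?thesis using v(3) that by simp
  qed
  then have "u = 0" by (rule ordered_basis_orthogonal_0[OF assms])
  then have "v $ j = 0" if "j < d" for j
    using that ordered_basis_coefficients_0[OF assms] by (simp add: u_def)
  then show False using v(1,2) by (auto intro: eq_vecI)
qed

text \<open>
  Existence comes from inverting the Gram matrix, uniqueness from nondegeneracy; both are needed to
  unfold the definite description.
\<close>
lemma reciprocal_basis:
  assumes "ordered_basis d x" "i < d" "j < d"
  shows "g (reciprocal_basis g d x i) (x j) = (if i = j then 1 else 0)"
proof -
  define G where "G = mat d d (\<lambda>(i, j). g (x i) (x j))"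
  have G: "G \<in> carrier_mat d d" by (simp add: G_def)
  have det: "det G \<noteq> 0" using gram_det_nonzero[OF assms(1)] by (simp add: gram_det_def G_def)
  define H where "H = adj_mat G"
  have H: "H \<in> carrier_mat d d" "G * H = det G \<cdot>\<^sub>m 1\<^sub>m d"
    using adj_mat[OF G] by (simp_all add: H_def)
  \<comment> \<open>The adjugate divided by the determinant is the inverse of the Gram matrix.\<close>
  define y where "y = (\<Sum>k<d. scale (H $$ (k, i) / det G) (x k))"
  have y: "g y (x j) = (if i = j then 1 else 0)" if "j < d" for j
  proof -
    have "(\<Sum>k<d. g (x j) (x k) * H $$ (k, i)) = (G * H) $$ (j, i)"
      using that assms(2) H(1) G by (simp add: scalar_prod_def G_def atLeast0LessThan)
    also have "\<dots> = (if i = j then det G else 0)" using that assms(2) by (simp add: H(2))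
    finally have eq: "(\<Sum>k<d. g (x j) (x k) * H $$ (k, i)) = (if i = j then det G else 0)" .
    have "g y (x j) = (\<Sum>k<d. g (x j) (x k) * H $$ (k, i)) / det G"
      by (simp add: y_def g_sum_left g_scale_left symmetric[of "x j"] sum_divide_distrib mult.commute)
    then show ?thesis using eq det by simp
  qed
  have "\<forall>j<d. g (reciprocal_basis g d x i) (x j) = (if i = j then 1 else 0)"
    unfolding reciprocal_basis_def
  proof (rule theI)
    show "\<forall>j<d. g y (x j) = (if i = j then 1 else 0)" using y by blast
    fix z assume "\<forall>j<d. g z (x j) = (if i = j then 1 else 0)"
    then have "z - y = 0"
      using y by (intro ordered_basis_orthogonal_0[OF assms(1)]) (simp add: g_diff_left)
    then show "z = y" by simp
  qed
  then show ?thesis using assms(3) by blast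
qed

lemma reciprocal_basis_expand:
  assumes "ordered_basis d x"
  shows "v = (\<Sum>j<d. scale (g v (x j)) (reciprocal_basis g d x j))"
proof -
  have "v - (\<Sum>j<d. scale (g v (x j)) (reciprocal_basis g d x j)) = 0"
  proof (rule ordered_basis_orthogonal_0[OF assms])
    fix i assume i: "i < d"
    have "(\<Sum>j<d. g v (x j) * g (reciprocal_basis g d x j) (x i)) = (\<Sum>j<d. if j = i then g v (x j) else 0)"
      using i reciprocal_basis[OF assms] by (intro sum.cong) auto
    then show "g (v - (\<Sum>j<d. scale (g v (x j)) (reciprocal_basis g d x j))) (x i) = 0"
      using i by (simp add: g_diff_left g_sum_left g_scale_left)
  qed
  then show ?thesis by simp
qed

lemma basis_expand_reciprocal:
  assumes "ordered_basis d x"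
  shows "v = (\<Sum>j<d. scale (g v (reciprocal_basis g d x j)) (x j))"
proof -
  obtain a where a: "v = (\<Sum>j<d. scale (a j) (x j))" using ordered_basis_expand[OF assms] .
  have "g v (reciprocal_basis g d x i) = a i" if "i < d" for i
  proof -
    have "(\<Sum>j<d. a j * g (reciprocal_basis g d x i) (x j)) = (\<Sum>j<d. if j = i then a j else 0)"
      using that reciprocal_basis[OF assms] by (intro sum.cong) auto
    then show ?thesis
      using that by (simp add: a g_sum_left g_scale_left symmetric[of "x _"])
  qed
  then show ?thesis using a by simp
qed

section \<open>The Hodge star as a contraction\<close>

text \<open>
  At each step the contracting vector pairs to \<open>1\<close> with the first remaining reciprocal vector and to
  \<open>0\<close> with all others.
\<close>
lemma contract_along_reciprocal:
  assumes "ordered_basis d x" "p permutes {0..<d}" "n \<le> d"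
  shows "contract_along g (monomial (map (\<lambda>k. x (p k)) [0..<n]))
      (monomial (map (\<lambda>k. reciprocal_basis g d x (p k)) [0..<d])) =
    monomial (map (\<lambda>k. reciprocal_basis g d x (p k)) [n..<d])"
  using assms(3)
proof (induction n)
  case 0
  then show ?case by simp
next
  case (Suc n)
  let ?y = "\<lambda>k. reciprocal_basis g d x (p k)"
  have p: "p k < d" if "k < d" for k using permutes_in_image[OF assms(2), of k] that by simp
  have inj: "p k = p l \<longleftrightarrow> k = l" for k l using permutes_inj[OF assms(2)] by (auto dest: injD)
  have "contract_along g (monomial (map (\<lambda>k. x (p k)) [0..<Suc n])) (monomial (map ?y [0..<d]))
     = contract g (x (p n)) (monomial (map ?y [n..<d]))"
    using Suc by (simp add: monomial_mult[symmetric] contract_along_mult contract_along_monomial[of _ "[_]"])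
  also have "[n..<d] = n # [Suc n..<d]" using Suc.prems by (simp add: upt_conv_Cons)
  also have "contract g (x (p n)) (monomial (map ?y (n # [Suc n..<d]))) = monomial (map ?y [Suc n..<d])"
  proof -
    have g: "g (x (p n)) (?y k) = (if k = n then 1 else 0)" if "k < d" for k
      using that Suc.prems p reciprocal_basis[OF assms(1), of "p k" "p n"]
      by (simp add: symmetric[of "x (p n)"] inj)
    then have "contract g (x (p n)) (monomial (map ?y [Suc n..<d])) = 0"
      by (intro contract_monomial_orthogonal) auto
    then show ?thesis using g Suc.prems by (simp add: contract_monomial_Cons)
  qed
  finally show ?case .
qed

text \<open>
  This replaces the definite description by a formula in which the basis enters only through
  its reciprocal volume. The reordering sign of the volume is exactly the sign in the definition
  of the star, and uniqueness holds because basis words span.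
\<close>
lemma hodge_star_eq:
  assumes "ordered_basis d x"
  shows "hodge_star scale g d x (exterior_class scale a) =
    exterior_class scale (contract_along g a (reciprocal_volume g d x))"
proof -
  let ?I = "exterior_ideal scale" and ?E = "exterior_class scale" and ?M = "exterior_algebra scale"
  let ?y = "reciprocal_basis g d x" and ?w = "reciprocal_volume g d x"
  let ?P = "\<lambda>T. T \<in> extensional (carrier ?M) \<and> linear_endo ?M T \<and>
        (\<forall>n\<le>d. \<forall>p. p permutes {0..<d} \<longrightarrow>
           T (wedge scale (map (\<lambda>k. x (p k)) [0..<n])) =
             of_int (sign p) \<odot>\<^bsub>?M\<^esub> wedge scale (map (\<lambda>k. ?y (p k)) [n..<d]))"
  \<comment> \<open>The class determines the contraction, so the choice of a representative is harmless.\<close>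
  define T where "T = restrict (\<lambda>c. ?E (contract_along g (SOME a. c = ?E a) ?w)) (carrier ?M)"
  have T: "T (?E a) = ?E (contract_along g a ?w)" for a
  proof -
    have "?E a = ?E (SOME b. ?E a = ?E b)" by (rule someI) simp
    then have "(SOME b. ?E a = ?E b) - a \<in> ?I"
      by (metis exterior_class_eq_iff)
    then have "contract_along g (SOME b. ?E a = ?E b) ?w = contract_along g a ?w"
      using contract_along_exterior_ideal_left[of _ ?w] by (fastforce simp: contract_along_diff_left)
    then show ?thesis by (simp add: T_def carrier_exterior_algebra)
  qed
  have "?P T"
  proof (intro conjI allI impI)
    show "T \<in> extensional (carrier ?M)" by (simp add: T_def)
    show "linear_endo ?M T"
      unfolding linear_endo_def
      by (auto simp: carrier_exterior_algebra T exterior_class_add exterior_class_smult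
          contract_along_add_left contract_along_const_left)
    fix n p assume n: "n \<le> d" and p: "p permutes {0..<d}"
    let ?s = "free_const (of_int (sign p)) :: 'v free_word \<Rightarrow>\<^sub>0 'f"
    let ?x = "monomial (map (\<lambda>k. x (p k)) [0..<n]) :: 'v free_word \<Rightarrow>\<^sub>0 'f"
    let ?yp = "monomial (map (\<lambda>k. ?y (p k)) [0..<d]) :: 'v free_word \<Rightarrow>\<^sub>0 'f"
    \<comment> \<open>Modulo the ideal, the volume is the permuted word times the sign, which is its own inverse.\<close>
    have "?s * (?yp - ?s * ?w) \<in> ?I"
      unfolding reciprocal_volume_def
      by (intro ideal_mult_left monomial_permute p)
    moreover have "?s * ?s = 1"
      by (simp add: free_const_mult[symmetric] flip: of_int_mult)
    then have "?s * (?yp - ?s * ?w) = ?s * ?yp - ?w"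
      by (simp add: right_diff_distrib mult.assoc[symmetric])
    ultimately have "contract_along g ?x (?s * ?yp - ?w) \<in> ?I"
      by (intro contract_along_exterior_ideal_right) simp
    then have "contract_along g ?x ?w - contract_along g ?x (?s * ?yp) \<in> ?I"
      using ideal_uminus by (fastforce simp: contract_along_diff_right)
    then have "T (?E ?x) = ?E (contract_along g ?x (?s * ?yp))"
      by (simp add: T exterior_class_eq_iff)
    also have "\<dots> = of_int (sign p) \<odot>\<^bsub>?M\<^esub> ?E (monomial (map (\<lambda>k. ?y (p k)) [n..<d]))"
      by (simp add: contract_along_const_right contract_along_reciprocal[OF assms p n] exterior_class_smult)
    finally show "T (wedge scale (map (\<lambda>k. x (p k)) [0..<n])) =
        of_int (sign p) \<odot>\<^bsub>?M\<^esub> wedge scale (map (\<lambda>k. ?y (p k)) [n..<d])"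
      by (simp add: wedge_eq_class)
  qed
  moreover have "S = T" if "?P S" for S
  proof -
    from that \<open>?P T\<close> have lin: "linear_endo ?M S" "linear_endo ?M T"
      and ext: "S \<in> extensional (carrier ?M)" "T \<in> extensional (carrier ?M)" by blast+
    define K where "K = {a. S (?E a) = T (?E a)}"
    have add: "U (?E (a + b)) = U (?E a) \<oplus>\<^bsub>?M\<^esub> U (?E b)"
      and const: "U (?E (free_const c * a)) = c \<odot>\<^bsub>?M\<^esub> U (?E a)"
      and mem: "U (?E a) \<in> range ?E"
      if "linear_endo ?M U" for U a b c
      using that unfolding linear_endo_def carrier_exterior_algebra
      by (auto simp: exterior_class_add[symmetric] exterior_class_smult[symmetric])
    have ideal: "?I \<subseteq> K"
    proof
      fix a assume "a \<in> ?I"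
      then have a: "?E a = ?E (free_const 0 * a)" by (simp add: exterior_class_eq_iff)
      have zero: "U (?E a) = ?E 0" if "linear_endo ?M U" for U
      proof -
        obtain b where "U (?E a) = ?E b" using mem[OF \<open>linear_endo ?M U\<close>] by blast
        then show ?thesis
          using const[OF that, of 0 a] a by (simp add: exterior_class_smult)
      qed
      from zero[OF lin(1)] zero[OF lin(2)] show "a \<in> K" by (simp add: K_def)
    qed
    note hom = add[OF lin(1)] add[OF lin(2)] const[OF lin(1)] const[OF lin(2)]
    have "monomial us \<in> K" for us
    proof (rule monomials_in_subspace[where y = x and n = "length us" and d = d, OF vector_space_axioms ideal])
      show "\<exists>a. v = (\<Sum>j<d. scale (a j) (x j))" for v
        using ordered_basis_expand[OF assms] by blast
      show "monomial (map (\<lambda>k. x (p k)) [0..<length us]) \<in> K"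
        if "p permutes {0..<d}" "length us \<le> d" for p
        using \<open>?P S\<close> \<open>?P T\<close> that by (simp add: K_def wedge_eq_class)
    qed (simp_all add: K_def hom)
    then have "S (?E a) = T (?E a)" for a
    proof (induction a rule: free_alg_induct)
      case zero
      then show ?case using ideal ideal_0 by (auto simp: K_def)
    qed (simp_all add: K_def hom)
    then show "S = T"
      using ext by (intro extensionalityI) (auto simp: carrier_exterior_algebra)
  qed
  ultimately have "hodge_star scale g d x = T"
    unfolding hodge_star_def by (rule the_equality)
  then show ?thesis by (simp add: T)
qed

lemma contract_along_reciprocal_volume:
  assumes "ordered_basis d x"
  shows "contract_along g (monomial (map x [0..<d])) (reciprocal_volume g d x) = 1"
  using contract_along_reciprocal[OF assms permutes_id, of d]
  by (simp add: reciprocal_volume_def monomial_Nil)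

section \<open>Changing the basis\<close>

text \<open>The top exterior power is spanned by the reciprocal volume of any basis.\<close>
lemma reciprocal_volume_proportional:
  assumes "ordered_basis d x" "ordered_basis d x'"
  obtains c where "reciprocal_volume g d x' - free_const c * reciprocal_volume g d x \<in> exterior_ideal scale"
proof -
  let ?I = "exterior_ideal scale" and ?w = "reciprocal_volume g d x"
  define K where "K = {a. \<exists>c. a - free_const c * ?w \<in> ?I}"
  have "reciprocal_volume g d x' \<in> K"
    unfolding reciprocal_volume_def[of g d x']
  proof (rule monomials_in_subspace[where y = "reciprocal_basis g d x" and n = d and d = d, OF vector_space_axioms])
    show "?I \<subseteq> K"
    proof
      fix a assume "a \<in> ?I"
      then have "a - free_const 0 * ?w \<in> ?I" by simp
      then show "a \<in> K" unfolding K_def by blast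
    qed
    show "a + b \<in> K" if ab: "a \<in> K" "b \<in> K" for a b
    proof -
      obtain c e where "a - free_const c * ?w \<in> ?I" "b - free_const e * ?w \<in> ?I"
        using ab by (auto simp: K_def)
      then have "(a - free_const c * ?w) + (b - free_const e * ?w) \<in> ?I" by (rule ideal_add)
      also have "(a - free_const c * ?w) + (b - free_const e * ?w) = a + b - free_const (c + e) * ?w"
        by (simp add: free_const_add distrib_right)
      finally show ?thesis unfolding K_def by blast
    qed
    show "free_const e * a \<in> K" if a: "a \<in> K" for e a
    proof -
      obtain c where "a - free_const c * ?w \<in> ?I" using a by (auto simp: K_def)
      then have "free_const e * (a - free_const c * ?w) \<in> ?I" by (rule ideal_mult_left)
      also have "free_const e * (a - free_const c * ?w) = free_const e * a - free_const (e * c) * ?w"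
        by (simp add: free_const_mult right_diff_distrib mult.assoc)
      finally show ?thesis unfolding K_def by blast
    qed
    show "\<exists>a. v = (\<Sum>j<d. scale (a j) (reciprocal_basis g d x j))" for v
      by (rule exI) (rule reciprocal_basis_expand[OF assms(1)])
    show "monomial (map (\<lambda>k. reciprocal_basis g d x (p k)) [0..<d]) \<in> K" if "p permutes {0..<d}" for p
      using monomial_permute[OF that, of "reciprocal_basis g d x" scale]
      unfolding K_def reciprocal_volume_def by blast
  qed simp
  then show thesis using that by (auto simp: K_def)
qed

lemma free_const_mem_exterior_ideal: "free_const c \<in> exterior_ideal scale \<longleftrightarrow> c = 0"
  using lookup_0_exterior_ideal[of "free_const c" scale] ideal_0[of scale]
  by (auto simp: free_const_def)

text \<open>
  The volume is not a torsion element: contracting along the basis turns \<open>c\<close> times the volume into the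
  scalar \<open>c\<close>, which is detected by the augmentation.
\<close>
lemma free_const_reciprocal_volume_mem_ideal:
  assumes "ordered_basis d x"
  shows "free_const c * reciprocal_volume g d x \<in> exterior_ideal scale \<longleftrightarrow> c = 0"
proof
  assume "free_const c * reciprocal_volume g d x \<in> exterior_ideal scale"
  from contract_along_exterior_ideal_right[OF this, of "monomial (map x [0..<d])"]
  show "c = 0"
    by (simp add: contract_along_const_right contract_along_reciprocal_volume[OF assms]
        free_const_mem_exterior_ideal)
qed (simp add: ideal_0)

text \<open>
  With \<open>A\<close> the matrix of \<open>x'\<close> in terms of \<open>x\<close>, contracting both volumes along the word \<open>x'\<close> gives
  \<open>1 = c * det A\<close>, while bilinearity gives \<open>G' = A * G * A\<^sup>T\<close> for the Gram matrices.
\<close>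
lemma gram_det_reciprocal_volume:
  assumes x: "ordered_basis d x" and x': "ordered_basis d x'"
    and c: "reciprocal_volume g d x' - free_const c * reciprocal_volume g d x \<in> exterior_ideal scale"
  shows "gram_det g d x = c\<^sup>2 * gram_det g d x'"
proof -
  let ?y = "reciprocal_basis g d x"
  define A where "A = mat d d (\<lambda>(i, j). g (x' i) (?y j))"
  define G where "G = mat d d (\<lambda>(i, j). g (x i) (x j))"
  define G' where "G' = mat d d (\<lambda>(i, j). g (x' i) (x' j))"
  have A: "A \<in> carrier_mat d d" and G: "G \<in> carrier_mat d d" by (simp_all add: A_def G_def)
  have "contract_along g (monomial (map x' [0..<d])) (reciprocal_volume g d x) = free_const (det A)"
    unfolding reciprocal_volume_def
    by (subst contract_along_det[where n = d]) (auto simp: A_def intro!: arg_cong[where f = det] arg_cong[where f = free_const] eq_matI)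
  with contract_along_exterior_ideal_right[OF c, of "monomial (map x' [0..<d])"]
  have "free_const (1 - c * det A) \<in> exterior_ideal scale"
    by (simp add: contract_along_diff_right contract_along_const_right
        contract_along_reciprocal_volume[OF x'] free_const_diff free_const_mult)
  then have cA: "c * det A = 1" by (simp add: free_const_mem_exterior_ideal)
  have AG: "(A * G) $$ (i, j) = g (x' i) (x j)" if "i < d" "j < d" for i j
  proof -
    have "(A * G) $$ (i, j) = (\<Sum>k<d. g (x' i) (?y k) * g (x k) (x j))"
      using that by (simp add: A_def G_def scalar_prod_def atLeast0LessThan)
    also have "\<dots> = g (\<Sum>k<d. scale (g (x' i) (?y k)) (x k)) (x j)"
      by (simp add: g_sum_left g_scale_left)
    finally show ?thesis by (simp only: basis_expand_reciprocal[OF x, symmetric])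
  qed
  have "A * G * transpose_mat A = G'"
  proof (rule eq_matI)
    fix i j assume "i < dim_row G'" "j < dim_col G'"
    then have ij: "i < d" "j < d" by (simp_all add: G'_def)
    have "(B * transpose_mat A) $$ (i, j) = (\<Sum>k<d. B $$ (i, k) * A $$ (j, k))" if "B \<in> carrier_mat d d" for B
      using that A ij by (simp add: scalar_prod_def atLeast0LessThan)
    from this[OF mult_carrier_mat[OF A G]]
    have "(A * G * transpose_mat A) $$ (i, j) = (\<Sum>k<d. (A * G) $$ (i, k) * A $$ (j, k))" .
    also have "\<dots> = (\<Sum>k<d. g (x' i) (x k) * g (x' j) (?y k))"
      using ij AG by (simp add: A_def)
    also have "\<dots> = g (x' i) (\<Sum>k<d. scale (g (x' j) (?y k)) (x k))"
      by (simp add: g_sum_right g_scale_right mult.commute)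
    also have "\<dots> = g (x' i) (x' j)"
      by (simp only: basis_expand_reciprocal[OF x, symmetric])
    also have "\<dots> = G' $$ (i, j)" using ij by (simp add: G'_def)
    finally show "(A * G * transpose_mat A) $$ (i, j) = G' $$ (i, j)" .
  qed (simp_all add: A_def G'_def)
  then have "det G' = det A * det G * det A"
    using A G det_mult[of "A * G" d "transpose_mat A"] det_mult[OF A G] det_transpose[OF A] by simp
  then have "c\<^sup>2 * det G' = (c * det A)\<^sup>2 * det G" by (simp add: power2_eq_square mult_ac)
  then show ?thesis using cA by (simp add: gram_det_def G_def G'_def)
qed

text \<open>
  One star is \<open>c\<close> times the other, as the volumes are. Conversely, evaluating at the unit recovers
  the volumes and hence \<open>c\<close>.
\<close>
lemma same_up_to_sign_hodge_star:
  assumes x: "ordered_basis d x" and x': "ordered_basis d x'"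
    and c: "reciprocal_volume g d x' - free_const c * reciprocal_volume g d x \<in> exterior_ideal scale"
  shows "same_up_to_sign (exterior_algebra scale) (hodge_star scale g d x) (hodge_star scale g d x')
    \<longleftrightarrow> c = 1 \<or> c = - 1"
proof -
  let ?w = "reciprocal_volume g d x" and ?w' = "reciprocal_volume g d x'"
  let ?I = "exterior_ideal scale"
  have multiple: "(\<forall>a. contract_along g a ?w' - free_const e * contract_along g a ?w \<in> ?I) \<longleftrightarrow> c = e" for e
  proof -
    have "(\<forall>a. contract_along g a ?w' - free_const e * contract_along g a ?w \<in> ?I) \<longleftrightarrow>
        (\<forall>a. contract_along g a (?w' - free_const e * ?w) \<in> ?I)"
      by (simp add: contract_along_diff_right contract_along_const_right)
    also have "\<dots> \<longleftrightarrow> ?w' - free_const e * ?w \<in> ?I"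
      using contract_along_exterior_ideal_right contract_along_1 by metis
    also have "\<dots> \<longleftrightarrow> free_const (c - e) * ?w \<in> ?I"
    proof -
      have eq: "?w' - free_const e * ?w = (?w' - free_const c * ?w) + free_const (c - e) * ?w"
        by (simp add: free_const_diff left_diff_distrib)
      show ?thesis
        using c ideal_add[OF c, of "free_const (c - e) * ?w"] ideal_diff[OF _ c, of "?w' - free_const e * ?w"]
        by (auto simp: eq)
    qed
    also have "\<dots> \<longleftrightarrow> c = e"
      using free_const_reciprocal_volume_mem_ideal[OF x] by simp
    finally show ?thesis .
  qed
  show ?thesis
    unfolding same_up_to_sign_def carrier_exterior_algebra ball_simps
    using multiple[of 1] multiple[of "- 1"]
    by (simp add: hodge_star_eq[OF x] hodge_star_eq[OF x'] exterior_class_uminus exterior_class_eq_iff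
        free_const_minus)
qed

end

theorem mainTheorem6:
  fixes scale :: "'f::field \<Rightarrow> 'v::ab_group_add \<Rightarrow> 'v"
    and g :: "'v \<Rightarrow> 'v \<Rightarrow> 'f"
    and d :: nat
    and x x' :: "nat \<Rightarrow> 'v"
  assumes "scalar_product_space scale g"
    and "d = vector_space.dim scale UNIV"
    and "vector_space.ordered_basis scale d x"
    and "vector_space.ordered_basis scale d x'"
  shows "same_up_to_sign (exterior_algebra scale) (hodge_star scale g d x) (hodge_star scale g d x')
         \<longleftrightarrow> gram_det g d x = gram_det g d x'"
proof -
  interpret scalar_product_space scale g by fact
  obtain c where c: "reciprocal_volume g d x' - free_const c * reciprocal_volume g d x \<in> exterior_ideal scale"
    using reciprocal_volume_proportional[OF assms(3,4)] .
  have "gram_det g d x = gram_det g d x' \<longleftrightarrow> c\<^sup>2 = 1"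
    using gram_det_reciprocal_volume[OF assms(3,4) c] gram_det_nonzero[OF assms(4)] by simp
  then show ?thesis
    using same_up_to_sign_hodge_star[OF assms(3,4) c] by (simp add: power2_eq_1_iff)
qed

end
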